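(* Let $\mathcal{A}$ be an $m$-order $n$-dimensional real tensor whose off-diagonal entries are all nonpositive. Then $\mathcal{A}$ is an $M$-tensor if and only if every eigenvalue of $\mathcal{A}$ has a positive real part.
   Context: Let $m\ge 2$ and $n\ge 1$ be integers. An $m$-order $n$-dimensional (square real) tensor is an array $\mathcal{A}=(A_{i_1\cdots i_m})$ with $A_{i_1\cdots i_m}\in\mathbb{R}$, $1\le i_1,\dots,i_m\le n$. Its diagonal entries are $A_{i\ldots i}$, $1\le i\le n$; all other entries are off-diagonal. It is nonnegative if all its entries are $\ge 0$. The unit tensor $\mathcal{I}$ has entries $\delta_{i_1\ldots i_m}=1$ if $i_1=\cdots=i_m$ and $0$ otherwise. For $x\in\mathbb{C}^n$, $\mathcal{A}x^{m-1}\in\mathbb{C}^n$ has $i$-th component $\sum_{i_2,\ldots,i_m=1}^n A_{ii_2\cdots i_m}x_{i_2}\cdots x_{i_m}$, and $x^{[m-1]}=(x_i^{m-1})_{1\le i\le n}$. A number $\lambda\in\mathbb{C}$ is an eigenvalue of $\mathcal{A}$ with eigenvector $x\in\mathbb{C}^n\setminus\{0\}$ if $\mathcal{A}x^{m-1}=\lambda x^{[m-1]}$. The spectral radius is $\rho(\mathcal{A})=\max\{|\lambda| : \lambda \text{ is an eigenvalue of } \mathcal{A}\}$. $\mathcal{A}$ is an $M$-tensor if there exist a nonnegative tensor $\mathcal{B}$ (of the same order and dimension) and a real number $c>\rho(\mathcal{B})$ such that $\mathcal{A}=c\mathcal{I}-\mathcal{B}$. *)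

theory Defs
  imports "HOL-Analysis.Analysis"
begin

text \<open>
  The order \<open>m\<close> of a tensor is an explicit natural number and its dimension is the cardinality of
  the finite (nonempty) index type \<open>'n\<close>. The entry at \<open>(i\<^sub>1, \<dots>, i\<^sub>m)\<close> is the value at the list
  \<open>[i\<^sub>1, \<dots>, i\<^sub>m]\<close>. Values at lists of length different from \<open>m\<close> carry no meaning, and every notion
  below disregards them; in particular equality of tensors is equality at all lists of length \<open>m\<close>.
\<close>

type_synonym 'n tensor = "'n list \<Rightarrow> real"

definition diagonal_index :: "nat \<Rightarrow> 'n list \<Rightarrow> bool" where
  "diagonal_index m is \<longleftrightarrow> (\<exists>i. is = replicate m i)"

definition tensor_eq :: "nat \<Rightarrow> 'n tensor \<Rightarrow> 'n tensor \<Rightarrow> bool" where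
  "tensor_eq m A B \<longleftrightarrow> (\<forall>is. length is = m \<longrightarrow> A is = B is)"

definition nonneg_tensor :: "nat \<Rightarrow> 'n tensor \<Rightarrow> bool" where
  "nonneg_tensor m A \<longleftrightarrow> (\<forall>is. length is = m \<longrightarrow> A is \<ge> 0)"

definition unit_tensor :: "nat \<Rightarrow> 'n tensor" where
  "unit_tensor m is = (if diagonal_index m is then 1 else 0)"

text \<open>The vector \<open>A x\<^sup>m\<^sup>-\<^sup>1\<close>; the list \<open>js\<close> is \<open>[i\<^sub>2, \<dots>, i\<^sub>m]\<close>.\<close>

definition tensor_apply :: "nat \<Rightarrow> 'n::finite tensor \<Rightarrow> complex ^ 'n \<Rightarrow> complex ^ 'n" where
  "tensor_apply m A x =
     (\<chi> i. \<Sum>js | length js = m - 1. of_real (A (i # js)) * (\<Prod>j\<leftarrow>js. x $ j))"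

definition tensor_eigenpair ::
  "nat \<Rightarrow> 'n::finite tensor \<Rightarrow> complex \<Rightarrow> complex ^ 'n \<Rightarrow> bool" where
  "tensor_eigenpair m A \<mu> x \<longleftrightarrow>
     x \<noteq> 0 \<and> tensor_apply m A x = (\<chi> i. \<mu> * (x $ i) ^ (m - 1))"

definition tensor_eigenvalue :: "nat \<Rightarrow> 'n::finite tensor \<Rightarrow> complex \<Rightarrow> bool" where
  "tensor_eigenvalue m A \<mu> \<longleftrightarrow> (\<exists>x. tensor_eigenpair m A \<mu> x)"

text \<open>
  \<^const>\<open>Greatest\<close> is the maximum of a set of reals without the a priori finiteness that
  \<^const>\<open>Max\<close> demands.
\<close>

definition tensor_spectral_radius :: "nat \<Rightarrow> 'n::finite tensor \<Rightarrow> real" where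
  "tensor_spectral_radius m A = (GREATEST r. \<exists>\<mu>. tensor_eigenvalue m A \<mu> \<and> r = cmod \<mu>)"

definition M_tensor :: "nat \<Rightarrow> 'n::finite tensor \<Rightarrow> bool" where
  "M_tensor m A \<longleftrightarrow>
     (\<exists>B c. nonneg_tensor m B \<and> c > tensor_spectral_radius m B \<and>
            tensor_eq m A (\<lambda>is. c * unit_tensor m is - B is))"

end

theory Submission
  imports Defs
begin

text \<open>
  Write \<open>A = c I - B\<close> with \<open>B\<close> nonnegative; the eigenvalues of \<open>A\<close> are the numbers \<open>c - \<mu>\<close> with
  \<open>\<mu>\<close> an eigenvalue of \<open>B\<close>. Both directions follow once \<open>\<rho>(B)\<close> is known to be an eigenvalue of \<open>B\<close>
  (the weak Perron--Frobenius theorem). For \<open>\<epsilon> > 0\<close>, Brouwer's theorem applied to the normalisation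
  of \<open>x \<mapsto> (B x\<^sup>m\<^sup>-\<^sup>1 + \<epsilon>)\<^bsup>1/(m-1)\<^esup>\<close> on the standard simplex gives a positive \<open>x\<close> with
  \<open>B x\<^sup>m\<^sup>-\<^sup>1 + \<epsilon> = s\<^sup>m\<^sup>-\<^sup>1 x\<^bsup>[m-1]\<^esup>\<close>. Comparing \<open>\<bar>y\<bar>\<close> with the least multiple of \<open>x\<close> above it shows
  \<open>\<bar>\<mu>\<bar> \<le> s\<^sup>m\<^sup>-\<^sup>1\<close> for each eigenpair \<open>(\<mu>, y)\<close> of \<open>B\<close>, and compactness lets \<open>\<epsilon>\<close> tend to \<open>0\<close>.
\<close>

text \<open>The action on real vectors: the order comparisons, the real roots and Brouwer's theorem
  are all applied there, and only the eigenpairs live over the complex numbers.\<close>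

definition real_tensor_apply :: "nat \<Rightarrow> 'n::finite tensor \<Rightarrow> real ^ 'n \<Rightarrow> real ^ 'n" where
  "real_tensor_apply m A x =
     (\<chi> i. \<Sum>js | length js = m - 1. A (i # js) * (\<Prod>j\<leftarrow>js. x $ j))"

section \<open>The standard simplex: convexity and compactness\<close>

definition std_simplex :: "(real ^ 'n::finite) set" where
  "std_simplex = {x. (\<forall>i. 0 \<le> x $ i) \<and> (\<Sum>i\<in>UNIV. x $ i) = 1}"

lemma finite_length_eq: "finite {js :: 'n::finite list. length js = k}"
  using finite_lists_length_eq[of "UNIV :: 'n set" k] by simp

lemma std_simplex_nonempty: "(std_simplex :: (real ^ 'n::finite) set) \<noteq> {}"
proof -
  have "(\<chi> i. 1 / real CARD('n)) \<in> (std_simplex :: (real ^ 'n) set)"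
    by (simp add: std_simplex_def)
  then show ?thesis by blast
qed

lemma std_simplex_nonzero: "x \<in> std_simplex \<Longrightarrow> x \<noteq> 0"
  by (auto simp: std_simplex_def)

lemma convex_std_simplex: "convex (std_simplex :: (real ^ 'n::finite) set)"
proof (rule convexI)
  fix x y :: "real ^ 'n" and u v :: real
  assume *: "x \<in> std_simplex" "y \<in> std_simplex" "0 \<le> u" "0 \<le> v" "u + v = 1"
  have "(\<Sum>i\<in>UNIV. (u *\<^sub>R x + v *\<^sub>R y) $ i) =
      u * (\<Sum>i\<in>UNIV. x $ i) + v * (\<Sum>i\<in>UNIV. y $ i)"
    by (simp add: sum.distrib sum_distrib_left)
  with * show "u *\<^sub>R x + v *\<^sub>R y \<in> std_simplex"
    by (simp add: std_simplex_def)
qed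

lemma compact_std_simplex: "compact (std_simplex :: (real ^ 'n::finite) set)"
proof -
  have "std_simplex = {x :: real ^ 'n. \<forall>i. 0 \<le> x $ i} \<inter> {x. (\<Sum>i\<in>UNIV. x $ i) = 1}"
    by (auto simp: std_simplex_def)
  moreover have "closed {x :: real ^ 'n. \<forall>i. 0 \<le> x $ i}"
    by (intro closed_Collect_all closed_Collect_le continuous_intros)
  moreover have "closed {x :: real ^ 'n. (\<Sum>i\<in>UNIV. x $ i) = 1}"
    by (intro closed_Collect_eq continuous_intros)
  ultimately have "closed (std_simplex :: (real ^ 'n) set)"
    by (metis closed_Int)
  moreover have "norm x \<le> 1" if "x \<in> std_simplex" for x :: "real ^ 'n"
    using norm_le_l1_cart[of x] that by (simp add: std_simplex_def)
  then have "bounded (std_simplex :: (real ^ 'n) set)"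
    by (auto simp: bounded_iff)
  ultimately show ?thesis
    by (simp add: compact_eq_bounded_closed)
qed

section \<open>Continuity, monotonicity and homogeneity of the tensor action\<close>

lemma continuous_real_tensor_apply:
  "continuous_on S (real_tensor_apply m A)"
proof -
  have "continuous_on S (\<lambda>x. \<Prod>j\<leftarrow>js. x $ j)" for js and S :: "(real ^ 'a) set"
    by (induction js) (auto intro!: continuous_intros)
  then show ?thesis
    unfolding real_tensor_apply_def by (intro continuous_intros)
qed

lemma prod_list_nonneg:
  fixes f :: "'a \<Rightarrow> 'b::linordered_semidom"
  shows "(\<And>j. 0 \<le> f j) \<Longrightarrow> 0 \<le> (\<Prod>j\<leftarrow>js. f j)"
  by (induction js) auto

lemma prod_list_mono:
  fixes f :: "'a \<Rightarrow> 'b::linordered_semidom"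
  assumes "\<And>j. 0 \<le> f j" "\<And>j. f j \<le> g j"
  shows "(\<Prod>j\<leftarrow>js. f j) \<le> (\<Prod>j\<leftarrow>js. g j)"
proof (induction js)
  case (Cons a js)
  then show ?case
    using assms order_trans[OF assms] prod_list_nonneg[of f js]
    by (auto intro!: mult_mono)
qed simp

lemma prod_list_scale:
  fixes f :: "'a \<Rightarrow> 'b::comm_semiring_1"
  shows "(\<Prod>j\<leftarrow>js. t * f j) = t ^ length js * (\<Prod>j\<leftarrow>js. f j)"
  by (induction js) (auto simp: algebra_simps)

lemma norm_prod_list:
  fixes f :: "'a \<Rightarrow> 'b::{real_normed_div_algebra, comm_monoid_mult}"
  shows "norm (\<Prod>j\<leftarrow>js. f j) = (\<Prod>j\<leftarrow>js. norm (f j))"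
  by (induction js) (auto simp: norm_mult)

lemma of_real_prod_list:
  "of_real (\<Prod>j\<leftarrow>js. f j) = (\<Prod>j\<leftarrow>js. of_real (f j) :: complex)"
  by (induction js) auto

lemma real_tensor_apply_mono:
  assumes "m \<ge> 1" "nonneg_tensor m B" "\<And>j. 0 \<le> x $ j" "\<And>j. x $ j \<le> y $ j"
  shows "real_tensor_apply m B x $ i \<le> real_tensor_apply m B y $ i"
  using assms
  by (auto simp: real_tensor_apply_def nonneg_tensor_def
      intro!: sum_mono mult_left_mono prod_list_mono)

lemma real_tensor_apply_nonneg:
  assumes "m \<ge> 1" "nonneg_tensor m B" "\<And>j. 0 \<le> x $ j"
  shows "0 \<le> real_tensor_apply m B x $ i"
  using assms
  by (auto simp: real_tensor_apply_def nonneg_tensor_def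
      intro!: sum_nonneg mult_nonneg_nonneg prod_list_nonneg)

lemma real_tensor_apply_scale:
  "real_tensor_apply m B (t *\<^sub>R x) = t ^ (m - 1) *\<^sub>R real_tensor_apply m B x"
  by (auto simp: real_tensor_apply_def vec_eq_iff prod_list_scale sum_distrib_left
      intro!: sum.cong)

text \<open>Triangle inequality: the modulus is multiplicative on the products, and the entries of
  \<open>B\<close> are their own moduli.\<close>

lemma norm_tensor_apply_le:
  assumes "m \<ge> 1" "nonneg_tensor m B"
  shows "cmod (tensor_apply m B y $ i) \<le> real_tensor_apply m B (\<chi> j. cmod (y $ j)) $ i"
proof -
  have "cmod (tensor_apply m B y $ i)
      \<le> (\<Sum>js | length js = m - 1. cmod (of_real (B (i # js)) * (\<Prod>j\<leftarrow>js. y $ j)))"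
    by (simp add: tensor_apply_def norm_sum)
  also have "\<dots> = real_tensor_apply m B (\<chi> j. cmod (y $ j)) $ i"
    using assms
    by (auto simp: real_tensor_apply_def nonneg_tensor_def norm_mult norm_prod_list
        intro!: sum.cong)
  finally show ?thesis .
qed

lemma tensor_apply_of_real:
  "tensor_apply m B (\<chi> j. of_real (x $ j)) $ i = of_real (real_tensor_apply m B x $ i)"
  by (simp add: tensor_apply_def real_tensor_apply_def of_real_prod_list)

section \<open>The weak Perron-Frobenius theorem and the spectral radius\<close>

lemma perturbed_eigenvector_exists:
  fixes B :: "'n::finite tensor"
  assumes m: "m \<ge> 2" and B: "nonneg_tensor m B" and e: "e > 0"
  obtains x where "x \<in> std_simplex"
    "\<And>i. root (m - 1) (real_tensor_apply m B x $ i + e) =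
      (\<Sum>j\<in>UNIV. root (m - 1) (real_tensor_apply m B x $ j + e)) * x $ i"
proof -
  define F where "F x = (\<chi> i. root (m - 1) (real_tensor_apply m B x $ i + e))" for x
  define s where "s x = (\<Sum>j\<in>UNIV. F x $ j)" for x
  \<comment> \<open>The shift by \<open>e\<close> keeps every component positive even where
    \<open>B\<close> sends x to 0, so the normaliser \<open>s x\<close> never vanishes. That
    \<open>m - 1 > 0\<close> matters: \<open>root 0\<close> is constantly 0.\<close>
  have F_pos: "F x $ i > 0" if "x \<in> std_simplex" for x i
  proof -
    have "0 \<le> real_tensor_apply m B x $ i"
      using that m B by (intro real_tensor_apply_nonneg) (auto simp: std_simplex_def)
    then show ?thesis
      using m e by (simp add: F_def)
  qed
  have s_pos: "s x > 0" if "x \<in> std_simplex" for x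
    unfolding s_def by (rule sum_pos) (auto simp: F_pos that)
  have contF: "continuous_on std_simplex F"
    unfolding F_def by (intro continuous_intros continuous_real_tensor_apply)
  then have conts: "continuous_on std_simplex s"
    unfolding s_def by (intro continuous_intros)
  have "continuous_on std_simplex (\<lambda>x. (1 / s x) *\<^sub>R F x)"
    using s_pos by (intro continuous_intros contF conts) force
  moreover have "(\<lambda>x. (1 / s x) *\<^sub>R F x) \<in> std_simplex \<rightarrow> std_simplex"
  proof
    fix x :: "real ^ 'n" assume x: "x \<in> std_simplex"
    have "(\<Sum>i\<in>UNIV. F x $ i / s x) = 1"
      using s_pos[OF x] by (simp add: s_def flip: sum_divide_distrib)
    then show "(1 / s x) *\<^sub>R F x \<in> std_simplex"
      using s_pos[OF x] F_pos[OF x] by (auto simp: std_simplex_def less_imp_le)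
  qed
  ultimately obtain x where x: "x \<in> std_simplex" "(1 / s x) *\<^sub>R F x = x"
    using brouwer[OF compact_std_simplex convex_std_simplex std_simplex_nonempty] by blast
  have "F x $ i = s x * x $ i" for i
  proof -
    have "x $ i = (1 / s x) * F x $ i"
      by (subst (1) x(2)[symmetric]) simp
    then show ?thesis
      using s_pos[OF x(1)] by simp
  qed
  then show ?thesis
    unfolding F_def s_def vec_lambda_beta by (rule that[OF x(1)])
qed

text \<open>An upper bound of Collatz-Wielandt type. Where |y| <= t x is tight, the moduli in the
  eigenvalue equation for y meet the bound on x, and the common factor cancels.\<close>

lemma eigenvalue_norm_le_of_superharmonic:
  fixes B :: "'n::finite tensor"
  assumes m: "m \<ge> 1" and B: "nonneg_tensor m B"
    and x: "\<And>i. x $ i > 0" "\<And>i. real_tensor_apply m B x $ i \<le> r * (x $ i) ^ (m - 1)"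
    and \<mu>: "tensor_eigenvalue m B \<mu>"
  shows "cmod \<mu> \<le> r"
proof -
  obtain y where y: "y \<noteq> 0" "tensor_apply m B y = (\<chi> i. \<mu> * (y $ i) ^ (m - 1))"
    using \<mu> by (auto simp: tensor_eigenvalue_def tensor_eigenpair_def)
  \<comment> \<open>The least t with |y| <= t x; since the index type is finite, equality holds at
    some index k.\<close>
  define t where "t = Max (range (\<lambda>i. cmod (y $ i) / x $ i))"
  have "t \<in> range (\<lambda>i. cmod (y $ i) / x $ i)"
    unfolding t_def by (rule Max_in) auto
  then obtain k where k: "t = cmod (y $ k) / x $ k" by auto
  have ratio_le: "cmod (y $ i) / x $ i \<le> t" for i
    unfolding t_def by (rule Max_ge) auto
  have le: "cmod (y $ i) \<le> t * x $ i" for i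
    using ratio_le[of i] x(1)[of i] by (simp add: pos_divide_le_eq)
  have yk: "cmod (y $ k) = t * x $ k"
    using k x(1)[of k] by simp
  \<comment> \<open>A nonzero y forces t > 0, which permits the final cancellation of
    \<open>(t * x $ k) ^ (m - 1)\<close>.\<close>
  obtain j where "y $ j \<noteq> 0"
    using y(1) by (auto simp: vec_eq_iff)
  then have "0 < t * x $ j"
    using le[of j] by (smt (verit) zero_less_norm_iff)
  then have t: "t > 0"
    using x(1)[of j] by (simp add: zero_less_mult_iff)
  have "cmod \<mu> * (t * x $ k) ^ (m - 1) = cmod (tensor_apply m B y $ k)"
    by (simp add: y(2) norm_mult norm_power yk)
  also have "\<dots> \<le> real_tensor_apply m B (\<chi> j. cmod (y $ j)) $ k"
    by (rule norm_tensor_apply_le[OF m B])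
  also have "\<dots> \<le> real_tensor_apply m B (t *\<^sub>R x) $ k"
    using le by (intro real_tensor_apply_mono[OF m B]) auto
  also have "\<dots> \<le> t ^ (m - 1) * (r * (x $ k) ^ (m - 1))"
    using t x(2)[of k] by (simp add: real_tensor_apply_scale)
  also have "\<dots> = r * (t * x $ k) ^ (m - 1)"
    by (simp add: power_mult_distrib)
  finally show ?thesis
    using t x(1)[of k] by (simp add: mult_le_cancel_right)
qed

text \<open>The limiting eigenvector may have zero components, so the bound on eigenvalues cannot be
  read off from it. It is proved for each positive perturbed vector and then passed to the
  limit.\<close>

lemma weak_perron_frobenius:
  fixes B :: "'n::finite tensor"
  assumes m: "m \<ge> 2" and B: "nonneg_tensor m B"
  obtains r where "r \<ge> 0" "tensor_eigenvalue m B (of_real r)"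
    "\<And>\<mu>. tensor_eigenvalue m B \<mu> \<Longrightarrow> cmod \<mu> \<le> r"
proof -
  define F where "F e x = (\<chi> i. root (m - 1) (real_tensor_apply m B x $ i + e))" for e x
  define s where "s e x = (\<Sum>j\<in>UNIV. F e x $ j)" for e x
  define e where "e k = inverse (real (Suc k))" for k
  have e_pos: "e k > 0" for k by (simp add: e_def)
  have "\<exists>x. x \<in> std_simplex \<and> (\<forall>i. F (e k) x $ i = s (e k) x * x $ i)" for k
    using perturbed_eigenvector_exists[OF m B e_pos[of k]]
    by (metis (no_types, lifting) F_def s_def vec_lambda_beta sum.cong)
  then obtain x where x: "\<And>k. x k \<in> std_simplex"
    "\<And>k i. F (e k) (x k) $ i = s (e k) (x k) * x k $ i"
    by metis
  \<comment> \<open>The case \<open>d = 0\<close> is included so that these facts serve the limit as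
    well as the perturbed vectors.\<close>
  have Fpow: "(F d z $ i) ^ (m - 1) = real_tensor_apply m B z $ i + d"
    and F_nonneg: "0 \<le> F d z $ i" if "z \<in> std_simplex" "d \<ge> 0" for d z i
  proof -
    have "0 \<le> real_tensor_apply m B z $ i"
      using that m B by (intro real_tensor_apply_nonneg) (auto simp: std_simplex_def)
    then show "(F d z $ i) ^ (m - 1) = real_tensor_apply m B z $ i + d" "0 \<le> F d z $ i"
      using m that by (simp_all add: F_def)
  qed
  have bound: "cmod \<mu> \<le> s (e k) (x k) ^ (m - 1)" if "tensor_eigenvalue m B \<mu>" for \<mu> k
  proof (rule eigenvalue_norm_le_of_superharmonic[OF _ B _ _ that])
    show "m \<ge> 1" using m by simp
    show "0 < x k $ i" for i
    proof -
      have "F (e k) (x k) $ i > 0"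
        using real_tensor_apply_nonneg[of m B "x k" i] x(1)[of k] m B e_pos[of k]
        by (auto simp: F_def std_simplex_def intro!: add_nonneg_pos)
      \<comment> \<open>A zero component of x would make the right side of \<open>F = s * x\<close>
        vanish, although F is positive.\<close>
      then have "x k $ i \<noteq> 0"
        using x(2)[of k i] by auto
      then show ?thesis
        using x(1)[of k] by (auto simp: std_simplex_def less_le)
    qed
    \<comment> \<open>The perturbed equation holds with \<open>e k\<close> added on the left;
      dropping this positive term leaves the inequality.\<close>
    show "real_tensor_apply m B (x k) $ i \<le> s (e k) (x k) ^ (m - 1) * (x k $ i) ^ (m - 1)" for i
      using Fpow[OF x(1)[of k], of "e k" i] e_pos[of k]
      by (simp add: x(2) power_mult_distrib)
  qed
  \<comment> \<open>Compactness is applied to the vectors only; the scalars s then converge by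
    continuity, being sums of components of F.\<close>
  obtain z h where z: "z \<in> std_simplex" and h: "strict_mono h" and lim: "(x \<circ> h) \<longlonglongrightarrow> z"
    using compact_std_simplex x(1) unfolding compact_def by metis
  have "(\<lambda>k. e (h k)) \<longlonglongrightarrow> 0"
    using LIMSEQ_subseq_LIMSEQ[OF LIMSEQ_inverse_real_of_nat h] by (simp add: e_def o_def)
  moreover have lim': "(\<lambda>k. x (h k)) \<longlonglongrightarrow> z"
    using lim by (simp add: o_def)
  moreover have "(\<lambda>k. real_tensor_apply m B (x (h k))) \<longlonglongrightarrow> real_tensor_apply m B z"
    by (rule continuous_on_tendsto_compose[OF continuous_real_tensor_apply[of UNIV] lim']) auto
  \<comment> \<open>The root is continuous at 0 too, so vanishing components of the limit do no
    harm.\<close>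
  ultimately have "(\<lambda>k. root (m - 1) (real_tensor_apply m B (x (h k)) $ i + e (h k)))
      \<longlonglongrightarrow> root (m - 1) (real_tensor_apply m B z $ i + 0)" for i
    by (intro tendsto_intros)
  then have limF: "(\<lambda>k. F (e (h k)) (x (h k)) $ i) \<longlonglongrightarrow> F 0 z $ i" for i
    by (simp add: F_def)
  then have lims: "(\<lambda>k. s (e (h k)) (x (h k))) \<longlonglongrightarrow> s 0 z"
    unfolding s_def by (rule tendsto_sum)
  have "(\<lambda>k. F (e (h k)) (x (h k)) $ i) \<longlonglongrightarrow> s 0 z * z $ i" for i
    unfolding x(2) by (intro tendsto_intros lims lim')
  then have eq: "F 0 z $ i = s 0 z * z $ i" for i
    using limF LIMSEQ_unique by blast
  define r where "r = s 0 z ^ (m - 1)"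
  have "real_tensor_apply m B z $ i = r * (z $ i) ^ (m - 1)" for i
    using Fpow[OF z, of 0 i] by (simp add: eq r_def power_mult_distrib)
  then have "tensor_apply m B (\<chi> j. of_real (z $ j)) =
      (\<chi> i. of_real r * ((\<chi> j. of_real (z $ j)) $ i) ^ (m - 1))"
    by (simp add: vec_eq_iff tensor_apply_of_real)
  moreover have "(\<chi> j. complex_of_real (z $ j)) \<noteq> 0"
    using std_simplex_nonzero[OF z] by (auto simp: vec_eq_iff)
  ultimately have "tensor_eigenvalue m B (of_real r)"
    by (auto simp: tensor_eigenvalue_def tensor_eigenpair_def)
  moreover have "r \<ge> 0"
    unfolding r_def s_def by (intro zero_le_power sum_nonneg F_nonneg z order_refl)
  moreover have "cmod \<mu> \<le> r" if "tensor_eigenvalue m B \<mu>" for \<mu>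
    unfolding r_def
    by (rule LIMSEQ_le_const[OF tendsto_power[OF lims]]) (use bound[OF that] in auto)
  ultimately show ?thesis
    using that by blast
qed

text \<open>\<open>GREATEST\<close> has the intended value only if a maximum is attained. The Perron
  value r attains it, and as r >= 0 it equals its own modulus, so the spectral radius is itself an
  eigenvalue.\<close>

lemma tensor_spectral_radius_nonneg_tensor:
  fixes B :: "'n::finite tensor"
  assumes "m \<ge> 2" "nonneg_tensor m B"
  shows "tensor_eigenvalue m B (of_real (tensor_spectral_radius m B))"
    and "tensor_eigenvalue m B \<mu> \<Longrightarrow> cmod \<mu> \<le> tensor_spectral_radius m B"
proof -
  obtain r where r: "r \<ge> 0" "tensor_eigenvalue m B (of_real r)"
    "\<And>\<mu>. tensor_eigenvalue m B \<mu> \<Longrightarrow> cmod \<mu> \<le> r"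
    using weak_perron_frobenius[OF assms] by blast
  have "tensor_spectral_radius m B = r"
    unfolding tensor_spectral_radius_def
  proof (rule Greatest_equality)
    show "\<exists>\<mu>. tensor_eigenvalue m B \<mu> \<and> r = cmod \<mu>"
      using r(1,2) by (intro exI[of _ "of_real r"]) auto
  qed (use r(3) in auto)
  then show "tensor_eigenvalue m B (of_real (tensor_spectral_radius m B))"
    and "tensor_eigenvalue m B \<mu> \<Longrightarrow> cmod \<mu> \<le> tensor_spectral_radius m B"
    using r by auto
qed

section \<open>The unit tensor and the shift of eigenvalues\<close>

lemma tensor_apply_unit_tensor:
  fixes x :: "complex ^ 'n::finite"
  assumes "m \<ge> 1"
  shows "tensor_apply m (unit_tensor m) x $ i = (x $ i) ^ (m - 1)"
proof -
  obtain k where k: "m = Suc k" using assms by (cases m) auto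
  \<comment> \<open>In row i a single list js meets the diagonal, so the sum collapses to one
    term.\<close>
  have diag: "diagonal_index m (i # js) \<longleftrightarrow> js = replicate k i" for js
    by (auto simp: diagonal_index_def k)
  have "tensor_apply m (unit_tensor m) x $ i =
      (\<Sum>js | length js = k. if js = replicate k i then \<Prod>j\<leftarrow>js. x $ j else 0)"
    unfolding tensor_apply_def vec_lambda_beta
    by (rule sum.cong) (simp_all add: unit_tensor_def diag, simp add: k)
  also have "\<dots> = (\<Prod>j\<leftarrow>replicate k i. x $ j)"
    by (simp add: finite_length_eq)
  finally show ?thesis
    by (simp add: k prod_list_replicate)
qed

text \<open>The unit tensor sends x to the vector of powers \<open>x $ i ^ (m - 1)\<close>, so
  subtracting \<open>B\<close> from its c-fold turns the eigenvalue equations of \<open>A\<close>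
  and \<open>B\<close> into each other with the same eigenvector.\<close>

lemma tensor_eigenvalue_shift:
  fixes A B :: "'n::finite tensor"
  assumes "m \<ge> 1" and eq: "tensor_eq m A (\<lambda>is. c * unit_tensor m is - B is)"
  shows "tensor_eigenvalue m A \<mu> \<longleftrightarrow> tensor_eigenvalue m B (of_real c - \<mu>)"
proof -
  have entry: "A (i # js) = c * unit_tensor m (i # js) - B (i # js)" if "length js = m - 1" for i js
    using eq assms(1) that by (simp add: tensor_eq_def)
  have "tensor_apply m A x $ i =
      of_real c * tensor_apply m (unit_tensor m) x $ i - tensor_apply m B x $ i" for x i
    unfolding tensor_apply_def vec_lambda_beta sum_distrib_left sum_subtractf[symmetric]
    by (rule sum.cong) (simp_all add: entry algebra_simps)
  then have app: "tensor_apply m A x $ i =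
      of_real c * (x $ i) ^ (m - 1) - tensor_apply m B x $ i" for x i
    by (simp add: tensor_apply_unit_tensor[OF assms(1)])
  have "u - b = v \<longleftrightarrow> b = u - v" for u b v :: complex
    by (auto simp: algebra_simps)
  then have "tensor_eigenpair m A \<mu> x \<longleftrightarrow> tensor_eigenpair m B (of_real c - \<mu>) x" for x
    unfolding tensor_eigenpair_def vec_eq_iff vec_lambda_beta app left_diff_distrib
    by (simp only:)
  then show ?thesis
    by (simp add: tensor_eigenvalue_def)
qed

theorem theorem3p2:
  fixes m :: nat and A :: "'n::finite tensor"
  assumes "m \<ge> 2"
    and "\<And>is. length is = m \<Longrightarrow> \<not> diagonal_index m is \<Longrightarrow> A is \<le> 0"
  shows "M_tensor m A \<longleftrightarrow> (\<forall>\<mu>. tensor_eigenvalue m A \<mu> \<longrightarrow> Re \<mu> > 0)"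
proof
  assume "M_tensor m A"
  then obtain B c where B: "nonneg_tensor m B" "c > tensor_spectral_radius m B"
    and eq: "tensor_eq m A (\<lambda>is. c * unit_tensor m is - B is)"
    by (auto simp: M_tensor_def)
  show "\<forall>\<mu>. tensor_eigenvalue m A \<mu> \<longrightarrow> Re \<mu> > 0"
  proof (intro allI impI)
    fix \<mu> assume "tensor_eigenvalue m A \<mu>"
    then have "tensor_eigenvalue m B (of_real c - \<mu>)"
      using tensor_eigenvalue_shift[OF _ eq] assms(1) by simp
    \<comment> \<open>The eigenvalues of \<open>A\<close> lie in an open disc about c of radius c,
      which is contained in the right half-plane.\<close>
    then have "cmod (of_real c - \<mu>) < c"
      using tensor_spectral_radius_nonneg_tensor(2)[OF assms(1) B(1)] B(2) by force
    then show "Re \<mu> > 0"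
      using complex_Re_le_cmod[of "of_real c - \<mu>"] by simp
  qed
next
  assume pos: "\<forall>\<mu>. tensor_eigenvalue m A \<mu> \<longrightarrow> Re \<mu> > 0"
  \<comment> \<open>The largest diagonal entry is the least c that makes the diagonal of
    \<open>B\<close> nonnegative; off the diagonal \<open>B\<close> is -A, which is nonnegative by
    hypothesis.\<close>
  define c where "c = Max (range (\<lambda>i. A (replicate m i)))"
  define B where "B is = c * unit_tensor m is - A is" for "is"
  have "A (replicate m i) \<le> c" for i
    unfolding c_def by (rule Max_ge) auto
  then have "nonneg_tensor m B"
    using assms(2) by (auto simp: nonneg_tensor_def B_def unit_tensor_def diagonal_index_def)
  moreover have eq: "tensor_eq m A (\<lambda>is. c * unit_tensor m is - B is)"
    by (simp add: tensor_eq_def B_def)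
  \<comment> \<open>Since the spectral radius of \<open>B\<close> is an eigenvalue of
    \<open>B\<close>, its difference from c is a real eigenvalue of \<open>A\<close>, and positivity
    of that one number is the required inequality.\<close>
  moreover have "tensor_eigenvalue m A (of_real c - of_real (tensor_spectral_radius m B))"
    using tensor_eigenvalue_shift[OF _ eq] assms(1) \<open>nonneg_tensor m B\<close>
    by (simp add: tensor_spectral_radius_nonneg_tensor)
  then have "c > tensor_spectral_radius m B"
    using pos by fastforce
  ultimately show "M_tensor m A"
    unfolding M_tensor_def by blast
qed

end
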